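(* Let $R$ be a ring, $n\ge1$, let $\delta:R\to R$ be an endomorphism and let $T=[t_{i,j}]$ be a transitive matrix in $\mathrm{M}_n(\mathrm{Z}(R))$. If $A\in\mathrm{M}_n(R,\delta,T)$, then $$p_{A,k}(z),\ q_{A,k}(z)\in\mathrm{Fix}(\delta)[z]$$ for all $k\ge1$. In other words, the coefficients of the right characteristic polynomials $p_{A,k}(z)=\mathrm{rdet}_{(k)}(zI_n-A)$ and of the left characteristic polynomials $q_{A,k}(z)=\mathrm{ldet}_{(k)}(zI_n-A)$ are in $\mathrm{Fix}(\delta)$.
   Context: A ring means a not necessarily commutative ring with identity; endomorphisms preserve the identity. $\mathrm{Z}(R)$ is the center of $R$, $\mathrm{M}_n(R)$ the ring of $n\times n$ matrices over $R$, and $\mathrm{Fix}(\delta)=\{r\in R\mid\delta(r)=r\}$. A matrix $T=[t_{i,j}]$ is transitive if $t_{i,i}=1$ and $t_{i,j}t_{j,l}=t_{i,l}$ for all $i,j,l\in\{1,\ldots,n\}$. The supermatrix algebra is $$\mathrm{M}_n(R,\delta,T)=\{A=[a_{i,j}]\in\mathrm{M}_n(R)\mid \delta(a_{i,j})=t_{i,j}a_{i,j}\text{ for all }1\le i,j\le n\}.$$ For any ring $S$ and $A=[a_{i,j}]\in\mathrm{M}_n(S)$, the preadjoint $A^{\ast}=[a^{\ast}_{r,s}]$ is defined by $$a_{r,s}^{\ast}=\sum_{\tau,\pi}\mathrm{sgn}(\pi)\,a_{\tau(1),\pi(\tau(1))}\cdots a_{\tau(s-1),\pi(\tau(s-1))}\,a_{\tau(s+1),\pi(\tau(s+1))}\cdots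 a_{\tau(n),\pi(\tau(n))},$$ the sum being over all $\tau,\pi\in\mathrm{S}_n$ with $\tau(s)=s$, $\pi(s)=r$ (an empty product is $1$). The right adjoint sequence of $A$ is $P_1=A^{\ast}$, $P_{k+1}=(AP_1\cdots P_k)^{\ast}$ for $k\ge1$, and $\mathrm{rdet}_{(k)}(A)=\mathrm{tr}(AP_1\cdots P_k)$. The left adjoint sequence is $Q_1=A^{\ast}$, $Q_{k+1}=(Q_k\cdots Q_1A)^{\ast}$ for $k\ge1$, and $\mathrm{ldet}_{(k)}(A)=\mathrm{tr}(Q_k\cdots Q_1A)$. Here $\mathrm{tr}$ is the sum of the diagonal entries. $R[z]$ is the polynomial ring in a single commuting indeterminate $z$; the $k$-th right and left characteristic polynomials of $A\in\mathrm{M}_n(R)$ are $p_{A,k}(z)=\mathrm{rdet}_{(k)}(zI_n-A)$ and $q_{A,k}(z)=\mathrm{ldet}_{(k)}(zI_n-A)$, computed in $\mathrm{M}_n(R[z])$. *)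

theory Defs
  imports
    "HOL-Algebra.Ring"
    "HOL-Algebra.UnivPoly"
    "HOL-Combinatorics.Permutations"
begin

text \<open>
  A not necessarily commutative ring with identity is a record satisfying the predicate
  \<^const>\<open>ring\<close>. An \<open>n \<times> n\<close> matrix is a function of two indices of which only the values
  at indices in \<open>{1..n}\<close> are relevant. Every operation takes the ring \<open>S\<close> of entries as an
  argument, since it is used both over \<open>R\<close> and over the polynomial ring \<^term>\<open>UP R\<close>;
  the latter does not need \<open>R\<close> to be commutative, and its indeterminate commutes with
  the coefficients.
\<close>

type_synonym 'a sq_matrix = "nat \<Rightarrow> nat \<Rightarrow> 'a"

definition ring_center :: "('a, 'm) ring_scheme \<Rightarrow> 'a set" where
  "ring_center R = {c \<in> carrier R. \<forall>x \<in> carrier R. c \<otimes>\<^bsub>R\<^esub> x = x \<otimes>\<^bsub>R\<^esub> c}"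

definition fixed_set :: "('a, 'm) ring_scheme \<Rightarrow> ('a \<Rightarrow> 'a) \<Rightarrow> 'a set" where
  "fixed_set R \<delta> = {r \<in> carrier R. \<delta> r = r}"

definition fixed_ring :: "('a, 'm) ring_scheme \<Rightarrow> ('a \<Rightarrow> 'a) \<Rightarrow> ('a, 'm) ring_scheme" where
  "fixed_ring R \<delta> = R\<lparr>carrier := fixed_set R \<delta>\<rparr>"

definition matrices :: "nat \<Rightarrow> 'a set \<Rightarrow> 'a sq_matrix set" where
  "matrices n X = {A. \<forall>i \<in> {1..n}. \<forall>j \<in> {1..n}. A i j \<in> X}"

definition transitive_matrix :: "nat \<Rightarrow> ('a, 'm) ring_scheme \<Rightarrow> 'a sq_matrix \<Rightarrow> bool" where
  "transitive_matrix n R T \<longleftrightarrow>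
     (\<forall>i \<in> {1..n}. T i i = \<one>\<^bsub>R\<^esub>) \<and>
     (\<forall>i \<in> {1..n}. \<forall>j \<in> {1..n}. \<forall>l \<in> {1..n}. T i j \<otimes>\<^bsub>R\<^esub> T j l = T i l)"

definition supermatrices ::
    "nat \<Rightarrow> ('a, 'm) ring_scheme \<Rightarrow> ('a \<Rightarrow> 'a) \<Rightarrow> 'a sq_matrix \<Rightarrow> 'a sq_matrix set" where
  "supermatrices n R \<delta> T =
     {A \<in> matrices n (carrier R). \<forall>i \<in> {1..n}. \<forall>j \<in> {1..n}. \<delta> (A i j) = T i j \<otimes>\<^bsub>R\<^esub> A i j}"

definition matrix_mult ::
    "nat \<Rightarrow> ('a, 'm) ring_scheme \<Rightarrow> 'a sq_matrix \<Rightarrow> 'a sq_matrix \<Rightarrow> 'a sq_matrix" where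
  "matrix_mult n S A B = (\<lambda>i j. \<Oplus>\<^bsub>S\<^esub>k \<in> {1..n}. A i k \<otimes>\<^bsub>S\<^esub> B k j)"

definition matrix_trace :: "nat \<Rightarrow> ('a, 'm) ring_scheme \<Rightarrow> 'a sq_matrix \<Rightarrow> 'a" where
  "matrix_trace n S A = (\<Oplus>\<^bsub>S\<^esub>i \<in> {1..n}. A i i)"

text \<open>The product of a list in the given order, as the ring need not be commutative.\<close>

definition ordered_prod :: "('a, 'm) ring_scheme \<Rightarrow> 'a list \<Rightarrow> 'a" where
  "ordered_prod S xs = foldr (\<lambda>x y. x \<otimes>\<^bsub>S\<^esub> y) xs \<one>\<^bsub>S\<^esub>"

text \<open>
  In the preadjoint, \<open>i\<close> runs through \<open>1, \<dots>, s - 1, s + 1, \<dots>, n\<close> in increasing order,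
  and the integer \<open>sign \<pi>\<close> acts on \<open>S\<close> by integer multiples.
\<close>

definition preadjoint :: "nat \<Rightarrow> ('a, 'm) ring_scheme \<Rightarrow> 'a sq_matrix \<Rightarrow> 'a sq_matrix" where
  "preadjoint n S A = (\<lambda>r s.
     \<Oplus>\<^bsub>S\<^esub>\<tau> \<in> {\<tau>. \<tau> permutes {1..n} \<and> \<tau> s = s}. \<Oplus>\<^bsub>S\<^esub>\<pi> \<in> {\<pi>. \<pi> permutes {1..n} \<and> \<pi> s = r}.
       [sign \<pi>] \<cdot>\<^bsub>S\<^esub>
         ordered_prod S (map (\<lambda>i. A (\<tau> i) (\<pi> (\<tau> i))) ([1..<s] @ [Suc s..<Suc n])))"

text \<open>
  \<open>right_product n S A k\<close> is \<open>A P\<^sub>1 \<cdots> P\<^sub>k\<close> and \<open>left_product n S A k\<close> is \<open>Q\<^sub>k \<cdots> Q\<^sub>1 A\<close>.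
  The sequences \<open>P\<close> and \<open>Q\<close> are meaningful for indices \<open>k \<ge> 1\<close>; the lemmas below give
  their usual recursions.
\<close>

primrec right_product ::
    "nat \<Rightarrow> ('a, 'm) ring_scheme \<Rightarrow> 'a sq_matrix \<Rightarrow> nat \<Rightarrow> 'a sq_matrix" where
  "right_product n S A 0 = A"
| "right_product n S A (Suc k) =
     matrix_mult n S (right_product n S A k) (preadjoint n S (right_product n S A k))"

primrec left_product ::
    "nat \<Rightarrow> ('a, 'm) ring_scheme \<Rightarrow> 'a sq_matrix \<Rightarrow> nat \<Rightarrow> 'a sq_matrix" where
  "left_product n S A 0 = A"
| "left_product n S A (Suc k) =
     matrix_mult n S (preadjoint n S (left_product n S A k)) (left_product n S A k)"

definition right_adjoint ::
    "nat \<Rightarrow> ('a, 'm) ring_scheme \<Rightarrow> 'a sq_matrix \<Rightarrow> nat \<Rightarrow> 'a sq_matrix" where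
  "right_adjoint n S A k = preadjoint n S (right_product n S A (k - 1))"

definition left_adjoint ::
    "nat \<Rightarrow> ('a, 'm) ring_scheme \<Rightarrow> 'a sq_matrix \<Rightarrow> nat \<Rightarrow> 'a sq_matrix" where
  "left_adjoint n S A k = preadjoint n S (left_product n S A (k - 1))"

lemma right_adjoint_rec:
  "right_adjoint n S A 1 = preadjoint n S A"
  "right_adjoint n S A (Suc k) = preadjoint n S (right_product n S A k)"
  "right_product n S A (Suc k) =
     matrix_mult n S (right_product n S A k) (right_adjoint n S A (Suc k))"
  by (simp_all add: right_adjoint_def)

lemma left_adjoint_rec:
  "left_adjoint n S A 1 = preadjoint n S A"
  "left_adjoint n S A (Suc k) = preadjoint n S (left_product n S A k)"
  "left_product n S A (Suc k) =
     matrix_mult n S (left_adjoint n S A (Suc k)) (left_product n S A k)"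
  by (simp_all add: left_adjoint_def)

definition rdet :: "nat \<Rightarrow> ('a, 'm) ring_scheme \<Rightarrow> nat \<Rightarrow> 'a sq_matrix \<Rightarrow> 'a" where
  "rdet n S k A = matrix_trace n S (right_product n S A k)"

definition ldet :: "nat \<Rightarrow> ('a, 'm) ring_scheme \<Rightarrow> nat \<Rightarrow> 'a sq_matrix \<Rightarrow> 'a" where
  "ldet n S k A = matrix_trace n S (left_product n S A k)"

text \<open>The matrix \<open>z I\<^sub>n - A\<close> over \<open>R[z]\<close>: \<open>z\<close> is \<open>monom (UP R) \<one> 1\<close>, and the entries of
  \<open>A\<close> are regarded as constant polynomials.\<close>

definition char_matrix :: "('a, 'm) ring_scheme \<Rightarrow> 'a sq_matrix \<Rightarrow> (nat \<Rightarrow> 'a) sq_matrix" where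
  "char_matrix R A = (\<lambda>i j.
     (if i = j then monom (UP R) \<one>\<^bsub>R\<^esub> 1 else \<zero>\<^bsub>UP R\<^esub>) \<ominus>\<^bsub>UP R\<^esub> monom (UP R) (A i j) 0)"

definition right_char_poly ::
    "nat \<Rightarrow> ('a, 'm) ring_scheme \<Rightarrow> 'a sq_matrix \<Rightarrow> nat \<Rightarrow> nat \<Rightarrow> 'a" where
  "right_char_poly n R A k = rdet n (UP R) k (char_matrix R A)"

definition left_char_poly ::
    "nat \<Rightarrow> ('a, 'm) ring_scheme \<Rightarrow> 'a sq_matrix \<Rightarrow> nat \<Rightarrow> nat \<Rightarrow> 'a" where
  "left_char_poly n R A k = ldet n (UP R) k (char_matrix R A)"

end

theory Submission
  imports Defs
begin

text \<open>
  For central \<open>t\<close>, let \<open>E\<^sub>t = {x. \<delta> x = t x}\<close>. Then \<open>E\<^sub>s E\<^sub>t \<subseteq> E\<^sub>s\<^sub>t\<close>, so transitivity of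
  \<open>T\<close> makes the supermatrices closed under multiplication. Since \<open>T i j = (T i 1) (T 1 j)\<close>, the product of
  the \<open>T j (\<pi> j)\<close> over all \<open>j\<close> is \<open>1\<close> for every permutation \<open>\<pi>\<close>; leaving out the factor at
  \<open>j = s\<close>, where \<open>\<pi> s = r\<close>, gives \<open>T r s\<close>, so supermatrices are closed under the preadjoint as
  well. The trace of a supermatrix lies in \<open>E\<^sub>1 = Fix(\<delta>)\<close>. All this is applied over \<open>R[z]\<close>, with
  \<open>\<delta>\<close> acting on coefficients and \<open>T\<close> regarded as a matrix of constant polynomials, to \<open>z I - A\<close>.
\<close>

definition eigenspace :: "('a, 'm) ring_scheme \<Rightarrow> ('a \<Rightarrow> 'a) \<Rightarrow> 'a \<Rightarrow> 'a set" where
  "eigenspace R \<delta> t = {x \<in> carrier R. \<delta> x = t \<otimes>\<^bsub>R\<^esub> x}"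

text \<open>Reduces closure of supermatrices under an operation to closure properties of
  eigenspaces, entry by entry.\<close>

lemma supermatrices_iff:
  "A \<in> supermatrices n R \<delta> T \<longleftrightarrow>
     (\<forall>i \<in> {1..n}. \<forall>j \<in> {1..n}. A i j \<in> eigenspace R \<delta> (T i j))"
  by (auto simp: supermatrices_def matrices_def eigenspace_def)

section \<open>The center and products of central matrix entries along a permutation\<close>

lemma center_closed: "c \<in> ring_center R \<Longrightarrow> c \<in> carrier R"
  by (simp add: ring_center_def)

lemma center_commute:
  "c \<in> ring_center R \<Longrightarrow> x \<in> carrier R \<Longrightarrow> c \<otimes>\<^bsub>R\<^esub> x = x \<otimes>\<^bsub>R\<^esub> c"
  by (simp add: ring_center_def)

lemma (in ring) center_mult_closed:
  assumes x: "x \<in> ring_center R" and y: "y \<in> ring_center R"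
  shows "x \<otimes> y \<in> ring_center R"
proof -
  note xy = center_closed [OF x] center_closed [OF y]
  have "x \<otimes> y \<otimes> z = z \<otimes> (x \<otimes> y)" if z: "z \<in> carrier R" for z
  proof -
    have "x \<otimes> y \<otimes> z = x \<otimes> (z \<otimes> y)" using xy z by (simp add: m_assoc center_commute [OF y z])
    also have "\<dots> = x \<otimes> z \<otimes> y" using xy z by (simp add: m_assoc)
    finally show ?thesis using xy z by (simp add: center_commute [OF x z] m_assoc)
  qed
  thus ?thesis unfolding ring_center_def using xy by blast
qed

text \<open>Makes the unordered product \<open>finprod\<close> and its reindexing available for
  central elements, although \<open>R\<close> itself need not be commutative.\<close>

lemma (in ring) center_comm_monoid: "comm_monoid (R\<lparr>carrier := ring_center R\<rparr>)"
proof (rule comm_monoidI)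
  fix x y
  assume "x \<in> carrier (R\<lparr>carrier := ring_center R\<rparr>)" "y \<in> carrier (R\<lparr>carrier := ring_center R\<rparr>)"
  thus "x \<otimes>\<^bsub>R\<lparr>carrier := ring_center R\<rparr>\<^esub> y = y \<otimes>\<^bsub>R\<lparr>carrier := ring_center R\<rparr>\<^esub> x"
    by (simp add: center_commute center_closed)
next
  show "\<one>\<^bsub>R\<lparr>carrier := ring_center R\<rparr>\<^esub> \<in> carrier (R\<lparr>carrier := ring_center R\<rparr>)"
    by (simp add: ring_center_def)
qed (simp_all add: center_mult_closed center_closed m_assoc)

text \<open>The bridge from products in list order to \<open>finprod\<close>. Distinctness matters
  because \<open>set xs\<close> forgets repetitions.\<close>

lemma (in ring) ordered_prod_center:
  assumes "distinct xs" "\<And>x. x \<in> set xs \<Longrightarrow> f x \<in> ring_center R"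
  shows "ordered_prod R (map f xs) = finprod (R\<lparr>carrier := ring_center R\<rparr>) f (set xs)"
  using assms
proof (induction xs)
  case Nil
  interpret C: comm_monoid "R\<lparr>carrier := ring_center R\<rparr>" by (rule center_comm_monoid)
  show ?case using C.finprod_empty by (simp add: ordered_prod_def)
next
  case (Cons x xs)
  interpret C: comm_monoid "R\<lparr>carrier := ring_center R\<rparr>" by (rule center_comm_monoid)
  have "finprod (R\<lparr>carrier := ring_center R\<rparr>) f (insert x (set xs)) =
      f x \<otimes> finprod (R\<lparr>carrier := ring_center R\<rparr>) f (set xs)"
    using C.finprod_insert [of "set xs" x f] Cons.prems by auto
  thus ?case using Cons by (simp add: ordered_prod_def)
qed

text \<open>Each factor splits as \<open>T j 1\<close> times \<open>T 1 (\<pi> j)\<close>. Since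
  \<pi> permutes the indices, the second factors can be rearranged into the \<open>T 1 j\<close>,
  which cancel the \<open>T j 1\<close> one by one.\<close>

lemma (in ring) transitive_prod_permutation:
  assumes T: "T \<in> matrices n (ring_center R)" "transitive_matrix n R T"
    and \<pi>: "\<pi> permutes {1..n}"
  shows "finprod (R\<lparr>carrier := ring_center R\<rparr>) (\<lambda>j. T j (\<pi> j)) {1..n} = \<one>"
proof -
  let ?C = "R\<lparr>carrier := ring_center R\<rparr>"
  interpret C: comm_monoid ?C by (rule center_comm_monoid)
  have [simp]: "T i j \<in> ring_center R" if "1 \<le> i" "i \<le> n" "1 \<le> j" "j \<le> n" for i j
    using T(1) that by (auto simp: matrices_def)
  have tr: "T i j \<otimes> T j l = T i l" "T i i = \<one>"
    if "i \<in> {1..n}" "j \<in> {1..n}" "l \<in> {1..n}" for i j l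
    using T(2) that by (auto simp: transitive_matrix_def)
  have mem: "\<pi> j \<in> {1..n} \<and> 1 \<le> \<pi> j \<and> \<pi> j \<le> n" if "j \<in> {1..n}" for j
    using permutes_in_image [OF \<pi>, of j] that by auto
  \<comment> \<open>The index 1 is an arbitrary base point. It is out of range for
    \<open>n = 0\<close>, but then all products are empty.\<close>
  have "finprod ?C (\<lambda>j. T j (\<pi> j)) {1..n} = finprod ?C (\<lambda>j. T j 1 \<otimes>\<^bsub>?C\<^esub> T 1 (\<pi> j)) {1..n}"
    by (rule C.finprod_cong') (use tr mem in auto)
  also have "\<dots> = finprod ?C (\<lambda>j. T j 1) {1..n} \<otimes> finprod ?C (\<lambda>j. T 1 (\<pi> j)) {1..n}"
    using C.finprod_multf [of "\<lambda>j. T j 1" "{1..n}" "\<lambda>j. T 1 (\<pi> j)"] mem by simp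
  also have "finprod ?C (\<lambda>j. T 1 (\<pi> j)) {1..n} = finprod ?C (\<lambda>j. T 1 j) (\<pi> ` {1..n})"
    by (rule C.finprod_reindex [symmetric])
      (use mem permutes_inj_on [OF \<pi>] permutes_image [OF \<pi>] in auto)
  also have "\<pi> ` {1..n} = {1..n}" by (rule permutes_image [OF \<pi>])
  also have "finprod ?C (\<lambda>j. T j 1) {1..n} \<otimes> finprod ?C (\<lambda>j. T 1 j) {1..n} =
      finprod ?C (\<lambda>j. T j 1 \<otimes>\<^bsub>?C\<^esub> T 1 j) {1..n}"
    using C.finprod_multf [of "\<lambda>j. T j 1" "{1..n}" "\<lambda>j. T 1 j"] by simp
  also have "\<dots> = \<one>\<^bsub>?C\<^esub>"
    by (rule C.finprod_one_eqI) (use tr in auto)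
  finally show ?thesis by simp
qed

text \<open>The full product is \<open>\<one>\<close>, so the remaining product is inverse to the
  omitted factor \<open>T s (\<pi> s)\<close>. By transitivity \<open>T (\<pi> s) s\<close> is an
  inverse of that factor too.\<close>

lemma (in ring) transitive_prod_omit:
  assumes T: "T \<in> matrices n (ring_center R)" "transitive_matrix n R T"
    and \<pi>: "\<pi> permutes {1..n}" and s: "s \<in> {1..n}"
  shows "finprod (R\<lparr>carrier := ring_center R\<rparr>) (\<lambda>j. T j (\<pi> j)) ({1..n} - {s}) = T (\<pi> s) s"
proof -
  let ?C = "R\<lparr>carrier := ring_center R\<rparr>"
  interpret C: comm_monoid ?C by (rule center_comm_monoid)
  have mem: "\<pi> j \<in> {1..n}" if "j \<in> {1..n}" for j
    using permutes_in_image [OF \<pi>, of j] that by auto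
  have cen: "T i j \<in> ring_center R" if "i \<in> {1..n}" "j \<in> {1..n}" for i j
    using T(1) that by (auto simp: matrices_def)
  have cen': "T i j \<in> carrier R" if "i \<in> {1..n}" "j \<in> {1..n}" for i j
    using cen [OF that] by (rule center_closed)
  define c where "c = finprod ?C (\<lambda>j. T j (\<pi> j)) ({1..n} - {s})"
  have "c \<in> carrier ?C"
    unfolding c_def by (rule C.finprod_closed) (use cen mem in auto)
  hence c: "c \<in> carrier R" using center_closed by fastforce
  have "\<one> = finprod ?C (\<lambda>j. T j (\<pi> j)) (insert s ({1..n} - {s}))"
    using transitive_prod_permutation [OF T \<pi>] s by (simp add: insert_absorb)
  also have "\<dots> = T s (\<pi> s) \<otimes> c"
    using C.finprod_insert [of "{1..n} - {s}" s "\<lambda>j. T j (\<pi> j)"] cen mem s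
    by (auto simp: c_def)
  finally have "T s (\<pi> s) \<otimes> c = \<one>" by simp
  hence "T (\<pi> s) s \<otimes> (T s (\<pi> s) \<otimes> c) = T (\<pi> s) s"
    using cen' mem s by simp
  moreover have "T (\<pi> s) s \<otimes> T s (\<pi> s) = \<one>"
    using T(2) mem s by (simp add: transitive_matrix_def)
  ultimately have "c = T (\<pi> s) s"
    using c cen' mem s by (simp add: m_assoc [symmetric])
  thus ?thesis by (simp add: c_def)
qed

section \<open>Eigenspaces of an endomorphism with central eigenvalues\<close>

context ring
begin

context
  fixes \<delta> assumes \<delta>: "\<delta> \<in> ring_hom R R"
begin

interpretation H: ring_hom_ring R R \<delta>
  by (rule ring_hom_ringI2) (use \<delta> ring_axioms in auto)

lemma eigenspace_finsum:
  assumes "finite I" "t \<in> carrier R" "\<And>i. i \<in> I \<Longrightarrow> f i \<in> eigenspace R \<delta> t"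
  shows "finsum R f I \<in> eigenspace R \<delta> t"
proof -
  have f: "f \<in> I \<rightarrow> carrier R" using assms(3) by (auto simp: eigenspace_def)
  have "\<delta> (finsum R f I) = finsum R (\<delta> \<circ> f) I" using f by simp
  also have "\<dots> = (\<Oplus>i\<in>I. t \<otimes> f i)"
    by (rule finsum_cong') (use assms f in \<open>auto simp: eigenspace_def\<close>)
  also have "\<dots> = t \<otimes> finsum R f I" using assms f by (simp add: finsum_rdistr)
  finally show ?thesis using f by (simp add: eigenspace_def)
qed

text \<open>The sign is 1 or -1, so the integer multiple is \<open>x\<close> or its
  negative.\<close>

lemma eigenspace_sign:
  assumes "t \<in> carrier R" "x \<in> eigenspace R \<delta> t"
  shows "[sign \<pi>] \<cdot> x \<in> eigenspace R \<delta> t"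
  using assms
  by (cases \<pi> rule: sign_cases) (auto simp: eigenspace_def r_minus add_pow_int_ge add_pow_int_lt)

text \<open>In the product of \<open>s \<otimes> x\<close> and \<open>t \<otimes> y\<close>,
  centrality of \<open>t\<close> moves it to the left past \<open>x\<close>.\<close>

lemma eigenspace_mult:
  assumes "s \<in> carrier R" "t \<in> ring_center R" "x \<in> eigenspace R \<delta> s" "y \<in> eigenspace R \<delta> t"
  shows "x \<otimes> y \<in> eigenspace R \<delta> (s \<otimes> t)"
proof -
  have m: "s \<in> carrier R" "t \<in> carrier R" "x \<in> carrier R" "y \<in> carrier R" "x \<otimes> t = t \<otimes> x"
    using assms center_closed center_commute [OF assms(2), of x] by (auto simp: eigenspace_def)
  have "\<delta> (x \<otimes> y) = s \<otimes> x \<otimes> (t \<otimes> y)"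
    using assms(3,4) m(3,4) by (simp add: eigenspace_def)
  also have "\<dots> = s \<otimes> (x \<otimes> t) \<otimes> y" using m(1-4) by (simp add: m_assoc)
  also have "\<dots> = s \<otimes> t \<otimes> (x \<otimes> y)" unfolding m(5) using m(1-4) by (simp add: m_assoc)
  finally show ?thesis using m by (simp add: eigenspace_def)
qed

text \<open>The second conjunct is carried through the induction because
  \<open>eigenspace_mult\<close> requires the eigenvalue of the right factor, here the tail of the
  list, to be central.\<close>

lemma eigenspace_ordered_prod:
  assumes "\<And>i. i \<in> set xs \<Longrightarrow> t i \<in> ring_center R"
    "\<And>i. i \<in> set xs \<Longrightarrow> f i \<in> eigenspace R \<delta> (t i)"
  shows "ordered_prod R (map f xs) \<in> eigenspace R \<delta> (ordered_prod R (map t xs)) \<and>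
    ordered_prod R (map t xs) \<in> ring_center R"
  using assms
proof (induction xs)
  case Nil
  show ?case by (auto simp: ordered_prod_def eigenspace_def ring_center_def)
next
  case (Cons i xs)
  have "t i \<otimes> ordered_prod R (map t xs) \<in> ring_center R"
    using Cons by (simp add: center_mult_closed)
  moreover have "t i \<in> carrier R" using Cons.prems by (simp add: center_closed)
  ultimately show ?case using Cons by (simp add: ordered_prod_def eigenspace_mult)
qed

section \<open>Closure properties of supermatrices\<close>

context
  fixes n T
  assumes T: "T \<in> matrices n (ring_center R)" "transitive_matrix n R T"
begin

lemma matrix_entry_center: "i \<in> {1..n} \<Longrightarrow> j \<in> {1..n} \<Longrightarrow> T i j \<in> ring_center R"
  using T(1) by (auto simp: matrices_def)

lemma matrix_entry_carrier: "i \<in> {1..n} \<Longrightarrow> j \<in> {1..n} \<Longrightarrow> T i j \<in> carrier R"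
  by (intro center_closed matrix_entry_center)

text \<open>By transitivity the eigenvalue \<open>T i k \<otimes> T k j\<close> of a summand does
  not depend on \<open>k\<close>, so all summands share one eigenspace.\<close>

lemma supermatrices_mult:
  assumes A: "A \<in> supermatrices n R \<delta> T" and B: "B \<in> supermatrices n R \<delta> T"
  shows "matrix_mult n R A B \<in> supermatrices n R \<delta> T"
  unfolding supermatrices_iff matrix_mult_def
proof (intro ballI eigenspace_finsum)
  fix i j k assume ijk: "i \<in> {1..n}" "j \<in> {1..n}" "k \<in> {1..n}"
  have "A i k \<otimes> B k j \<in> eigenspace R \<delta> (T i k \<otimes> T k j)"
    using A B ijk matrix_entry_center matrix_entry_carrier by (intro eigenspace_mult) (auto simp: supermatrices_iff)
  thus "A i k \<otimes> B k j \<in> eigenspace R \<delta> (T i j)"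
    using T(2) ijk by (simp add: transitive_matrix_def)
qed (auto intro: matrix_entry_carrier)

text \<open>For fixed \<tau> and \<pi>, the eigenvalues of the factors multiply to
  \<open>T r s\<close>: \<tau> merely reorders them, and \<open>transitive_prod_omit\<close>
  evaluates their product.\<close>

lemma supermatrices_preadjoint:
  assumes A: "A \<in> supermatrices n R \<delta> T"
  shows "preadjoint n R A \<in> supermatrices n R \<delta> T"
  unfolding supermatrices_iff preadjoint_def
\<comment> \<open>The eigenvalue \<open>T r s\<close> depends on neither \<tau> nor \<pi>, so both
  sums and the sign can be stripped, leaving a single ordered product.\<close>
proof (intro ballI eigenspace_finsum eigenspace_sign)
  fix r s \<tau> \<pi>
  assume r: "r \<in> {1..n}" and s: "s \<in> {1..n}"
    and "\<tau> \<in> {\<tau>. \<tau> permutes {1..n} \<and> \<tau> s = s}" "\<pi> \<in> {\<pi>. \<pi> permutes {1..n} \<and> \<pi> s = r}"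
  hence \<tau>: "\<tau> permutes {1..n}" "\<tau> s = s" and \<pi>: "\<pi> permutes {1..n}" "\<pi> s = r" by auto
  let ?C = "R\<lparr>carrier := ring_center R\<rparr>" and ?xs = "[1..<s] @ [Suc s..<Suc n]"
  interpret C: comm_monoid ?C by (rule center_comm_monoid)
  have xs: "set ?xs = {1..n} - {s}" "distinct ?xs" using s by auto
  have mem: "\<pi> j \<in> {1..n}" "\<tau> j \<in> {1..n}" if "j \<in> {1..n}" for j
    using permutes_in_image [OF \<pi>(1)] permutes_in_image [OF \<tau>(1)] that by auto
  have inj: "inj \<tau>" using \<tau>(1) by (rule permutes_inj)
  \<comment> \<open>As \<tau> fixes \<open>s\<close>, it permutes the other indices, and reindexing
    by \<tau> removes it from the product.\<close>
  have img: "\<tau> ` ({1..n} - {s}) = {1..n} - {s}"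
    using image_set_diff [OF inj, of "{1..n}" "{s}"] permutes_image [OF \<tau>(1)] \<tau>(2) by simp
  \<comment> \<open>Only the product of the central eigenvalues is rearranged; the entries of
    \<open>A\<close> keep their order.\<close>
  have "ordered_prod R (map (\<lambda>i. T (\<tau> i) (\<pi> (\<tau> i))) ?xs) =
      finprod ?C (\<lambda>i. T (\<tau> i) (\<pi> (\<tau> i))) ({1..n} - {s})"
    unfolding xs(1) [symmetric]
    by (rule ordered_prod_center [OF xs(2)]) (use mem matrix_entry_center in \<open>unfold xs(1), blast\<close>)
  also have "\<dots> = finprod ?C (\<lambda>j. T j (\<pi> j)) (\<tau> ` ({1..n} - {s}))"
    by (rule C.finprod_reindex [symmetric])
      (use inj mem matrix_entry_center in \<open>auto simp: img inj_on_def\<close>)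
  also have "\<dots> = T r s"
    unfolding img using transitive_prod_omit [OF T \<pi>(1) s] \<pi>(2) by simp
  finally have "ordered_prod R (map (\<lambda>i. T (\<tau> i) (\<pi> (\<tau> i))) ?xs) = T r s" .
  moreover have "ordered_prod R (map (\<lambda>i. A (\<tau> i) (\<pi> (\<tau> i))) ?xs) \<in>
      eigenspace R \<delta> (ordered_prod R (map (\<lambda>i. T (\<tau> i) (\<pi> (\<tau> i))) ?xs))"
    by (rule eigenspace_ordered_prod [THEN conjunct1])
      (use A mem matrix_entry_center in \<open>unfold xs(1) supermatrices_iff, auto\<close>)
  ultimately show "ordered_prod R (map (\<lambda>i. A (\<tau> i) (\<pi> (\<tau> i))) ?xs) \<in> eigenspace R \<delta> (T r s)"
    by (simp only:)
qed (auto intro: matrix_entry_carrier finite_subset [OF _ finite_permutations])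

lemma supermatrices_right_product:
  "A \<in> supermatrices n R \<delta> T \<Longrightarrow> right_product n R A k \<in> supermatrices n R \<delta> T"
  by (induction k) (auto intro: supermatrices_mult supermatrices_preadjoint)

lemma supermatrices_left_product:
  "A \<in> supermatrices n R \<delta> T \<Longrightarrow> left_product n R A k \<in> supermatrices n R \<delta> T"
  by (induction k) (auto intro: supermatrices_mult supermatrices_preadjoint)

lemma supermatrices_trace:
  assumes "A \<in> supermatrices n R \<delta> T"
  shows "matrix_trace n R A \<in> fixed_set R \<delta>"
proof -
  have "matrix_trace n R A \<in> eigenspace R \<delta> \<one>"
    unfolding matrix_trace_def
  proof (intro eigenspace_finsum)
    fix i assume i: "i \<in> {1..n}"
    hence "A i i \<in> eigenspace R \<delta> (T i i)" using assms by (simp only: supermatrices_iff)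
    thus "A i i \<in> eigenspace R \<delta> \<one>" using T(2) i by (simp add: transitive_matrix_def)
  qed auto
  thus ?thesis by (auto simp: eigenspace_def fixed_set_def)
qed

end

section \<open>Passage to the polynomial ring, with \<delta> acting on coefficients\<close>

lemma UP_map_ring_hom: "(\<lambda>p. \<delta> \<circ> p) \<in> ring_hom (UP R) (UP R)"
proof (rule ring_hom_memI)
  have up: "\<delta> \<circ> p \<in> up R" if p: "p \<in> up R" for p
  proof (rule mem_upI)
    show "(\<delta> \<circ> p) i \<in> carrier R" for i using mem_upD [OF p] by simp
    obtain m where "bound \<zero> m p" using bound_upD [OF p] by blast
    \<comment> \<open>Since \<delta> maps zero to zero, a degree bound for \<open>p\<close> remains
      valid.\<close>
    hence "bound \<zero> m (\<delta> \<circ> p)" by (auto simp: bound_def)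
    thus "\<exists>m. bound \<zero> m (\<delta> \<circ> p)" ..
  qed
  show "\<delta> \<circ> p \<in> carrier (UP R)" if "p \<in> carrier (UP R)" for p
    using up that by (simp add: UP_def)
  show "\<delta> \<circ> \<one>\<^bsub>UP R\<^esub> = \<one>\<^bsub>UP R\<^esub>" by (auto simp: UP_def)
  fix p q assume "p \<in> carrier (UP R)" "q \<in> carrier (UP R)"
  hence pq: "p \<in> up R" "q \<in> up R" by (auto simp: UP_def)
  show "\<delta> \<circ> (p \<oplus>\<^bsub>UP R\<^esub> q) = (\<delta> \<circ> p) \<oplus>\<^bsub>UP R\<^esub> (\<delta> \<circ> q)"
    using pq up by (auto simp: UP_def mem_upD)
  show "\<delta> \<circ> (p \<otimes>\<^bsub>UP R\<^esub> q) = (\<delta> \<circ> p) \<otimes>\<^bsub>UP R\<^esub> (\<delta> \<circ> q)"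
  proof
    fix m
    \<comment> \<open>The coefficients of a product are finite convolution sums, which \<delta>
      respects.\<close>
    have "\<delta> (\<Oplus>i\<in>{..m}. p i \<otimes> q (m - i)) = (\<Oplus>i\<in>{..m}. (\<delta> \<circ> (\<lambda>i. p i \<otimes> q (m - i))) i)"
      using pq by (subst H.hom_finsum) (auto simp: mem_upD)
    also have "\<dots> = (\<Oplus>i\<in>{..m}. \<delta> (p i) \<otimes> \<delta> (q (m - i)))"
      by (rule finsum_cong') (use pq in \<open>auto simp: mem_upD\<close>)
    finally show "(\<delta> \<circ> (p \<otimes>\<^bsub>UP R\<^esub> q)) m = ((\<delta> \<circ> p) \<otimes>\<^bsub>UP R\<^esub> (\<delta> \<circ> q)) m"
      using pq up by (simp add: UP_def)
  qed
qed

end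

text \<open>In each convolution sum for the coefficient at \<open>m\<close> only one term survives:
  \<open>i = 0\<close> if the constant stands on the left, \<open>i = m\<close> if it stands on the
  right. The two terms agree because \<open>c\<close> is central in \<open>R\<close>.\<close>

lemma monom_center:
  assumes "c \<in> ring_center R"
  shows "monom (UP R) c 0 \<in> ring_center (UP R)"
proof -
  interpret P: UP_ring R "UP R" by unfold_locales
  have c: "c \<in> carrier R" "\<And>x. x \<in> carrier R \<Longrightarrow> c \<otimes> x = x \<otimes> c"
    using center_closed [OF assms] center_commute [OF assms] .
  have "monom (UP R) c 0 \<otimes>\<^bsub>UP R\<^esub> p = p \<otimes>\<^bsub>UP R\<^esub> monom (UP R) c 0"
    if p: "p \<in> carrier (UP R)" for p
  proof (rule P.up_eqI)
    fix m
    have "coeff (UP R) (monom (UP R) c 0 \<otimes>\<^bsub>UP R\<^esub> p) m =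
        (\<Oplus>i\<in>{..m}. if 0 = i then c \<otimes> coeff (UP R) p (m - i) else \<zero>)"
      using p c(1) by (auto intro!: finsum_cong' split: if_splits)
    also have "\<dots> = c \<otimes> coeff (UP R) p m"
      using finsum_singleton [of 0 "{..m}" "\<lambda>i. c \<otimes> coeff (UP R) p (m - i)"] p c(1) by simp
    also have "\<dots> = coeff (UP R) p m \<otimes> c" using p by (intro c(2)) simp
    also have "\<dots> = (\<Oplus>i\<in>{..m}. if m = i then coeff (UP R) p i \<otimes> c else \<zero>)"
      using finsum_singleton [of m "{..m}" "\<lambda>i. coeff (UP R) p i \<otimes> c"] p c(1) by simp
    also have "\<dots> = coeff (UP R) (p \<otimes>\<^bsub>UP R\<^esub> monom (UP R) c 0) m"
      using p c(1) by (auto intro!: finsum_cong' split: if_splits)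
    finally show "coeff (UP R) (monom (UP R) c 0 \<otimes>\<^bsub>UP R\<^esub> p) m =
        coeff (UP R) (p \<otimes>\<^bsub>UP R\<^esub> monom (UP R) c 0) m" .
  qed (use p c(1) in auto)
  thus ?thesis using c(1) by (simp add: ring_center_def)
qed

lemma transitive_matrix_monom:
  assumes T: "T \<in> matrices n (carrier R)" "transitive_matrix n R T"
  shows "transitive_matrix n (UP R) (\<lambda>i j. monom (UP R) (T i j) 0)"
proof -
  interpret P: UP_ring R "UP R" by unfold_locales
  have "monom (UP R) (T i j) 0 \<otimes>\<^bsub>UP R\<^esub> monom (UP R) (T j l) 0 = monom (UP R) (T i l) 0"
    if "i \<in> {1..n}" "j \<in> {1..n}" "l \<in> {1..n}" for i j l
  proof -
    have "T i j \<in> carrier R" "T j l \<in> carrier R" "T i j \<otimes> T j l = T i l"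
      using T that by (auto simp: matrices_def transitive_matrix_def)
    thus ?thesis using P.monom_mult [of "T i j" "T j l" 0 0] by simp
  qed
  thus ?thesis using T(2) by (simp add: transitive_matrix_def)
qed

text \<open>Off the diagonal the entry is the negative of the constant \<open>A i j\<close>. On the
  diagonal the eigenvalue is \<open>\<one>\<close>, and the indeterminate is fixed because \<delta>
  preserves \<open>\<one>\<close>.\<close>

lemma char_matrix_super:
  assumes \<delta>: "\<delta> \<in> ring_hom R R" and T: "T \<in> matrices n (carrier R)" "transitive_matrix n R T"
    and A: "A \<in> supermatrices n R \<delta> T"
  shows "char_matrix R A \<in>
    supermatrices n (UP R) (\<lambda>p. \<delta> \<circ> p) (\<lambda>i j. monom (UP R) (T i j) 0)"
  unfolding supermatrices_iff
proof (intro ballI)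
  interpret P: UP_ring R "UP R" by unfold_locales
  interpret H: ring_hom_ring "UP R" "UP R" "\<lambda>p. \<delta> \<circ> p"
    by (rule ring_hom_ringI2) (use UP_map_ring_hom [OF \<delta>] P.UP_ring in auto)
  interpret h: ring_hom_ring R R \<delta>
    by (rule ring_hom_ringI2) (use \<delta> ring_axioms in auto)
  have \<delta>_monom: "\<delta> \<circ> monom (UP R) a m = monom (UP R) (\<delta> a) m" if "a \<in> carrier R" for a m
    using that by (auto simp: UP_def)
  fix i j assume ij: "i \<in> {1..n}" "j \<in> {1..n}"
  have t: "T i j \<in> carrier R" "i = j \<Longrightarrow> T i j = \<one>"
    using T ij by (auto simp: matrices_def transitive_matrix_def)
  have a: "A i j \<in> carrier R" "\<delta> (A i j) = T i j \<otimes> A i j"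
    using A ij by (auto simp: supermatrices_iff eigenspace_def)
  have mm: "monom (UP R) (T i j \<otimes> A i j) 0 = monom (UP R) (T i j) 0 \<otimes>\<^bsub>UP R\<^esub> monom (UP R) (A i j) 0"
    using P.monom_mult [OF t(1) a(1), of 0 0] by simp
  show "char_matrix R A i j \<in> eigenspace (UP R) (\<lambda>p. \<delta> \<circ> p) (monom (UP R) (T i j) 0)"
    using t a \<delta>_monom
    by (cases "i = j")
      (auto simp: char_matrix_def eigenspace_def mm P.P.minus_eq P.P.r_minus P.P.r_distr)
qed

end

theorem corollary4p3:
  fixes R :: "('a, 'm) ring_scheme" and n k :: nat
    and \<delta> :: "'a \<Rightarrow> 'a" and T A :: "nat \<Rightarrow> nat \<Rightarrow> 'a"
  assumes "ring R"
    and "n \<ge> 1"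
    and "\<delta> \<in> ring_hom R R"
    and "T \<in> matrices n (ring_center R)"
    and "transitive_matrix n R T"
    and "A \<in> supermatrices n R \<delta> T"
    and "k \<ge> 1"
  shows "right_char_poly n R A k \<in> carrier (UP (fixed_ring R \<delta>))
       \<and> left_char_poly n R A k \<in> carrier (UP (fixed_ring R \<delta>))
       \<and> (\<forall>i. coeff (UP R) (right_char_poly n R A k) i \<in> fixed_set R \<delta>)
       \<and> (\<forall>i. coeff (UP R) (left_char_poly n R A k) i \<in> fixed_set R \<delta>)"
proof -
  interpret ring R by fact
  interpret P: UP_ring R "UP R" by unfold_locales
  let ?T = "\<lambda>i j. monom (UP R) (T i j) 0" and ?\<delta> = "\<lambda>p. \<delta> \<circ> p"
  have Tc: "T \<in> matrices n (carrier R)"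
    using assms(4) by (simp add: matrices_def center_closed)
  have T: "?T \<in> matrices n (ring_center (UP R))" "transitive_matrix n (UP R) ?T"
    using assms(4) monom_center transitive_matrix_monom [OF Tc assms(5)]
    by (auto simp: matrices_def)
  note hom = UP_map_ring_hom [OF assms(3)]
  note A = char_matrix_super [OF assms(3) Tc assms(5,6)]
  \<comment> \<open>The closure results are instantiated at the ring \<open>UP R\<close>, with the
    coefficientwise map and the constant polynomials \<open>?T\<close>.\<close>
  have "right_char_poly n R A k \<in> fixed_set (UP R) ?\<delta>"
    unfolding right_char_poly_def rdet_def
    by (intro P.P.supermatrices_trace [OF hom T] P.P.supermatrices_right_product [OF hom T] A)
  moreover have "left_char_poly n R A k \<in> fixed_set (UP R) ?\<delta>"
    unfolding left_char_poly_def ldet_def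
    by (intro P.P.supermatrices_trace [OF hom T] P.P.supermatrices_left_product [OF hom T] A)
  moreover have "p \<in> carrier (UP (fixed_ring R \<delta>)) \<and> (\<forall>i. coeff (UP R) p i \<in> fixed_set R \<delta>)"
    if p: "p \<in> fixed_set (UP R) ?\<delta>" for p
  proof -
    have up: "p \<in> up R" and "\<delta> \<circ> p = p" using p by (auto simp: fixed_set_def UP_def)
    hence fx: "p i \<in> fixed_set R \<delta>" for i
      by (auto simp: fixed_set_def dest: fun_cong [of _ _ i])
    \<comment> \<open>Only the carrier differs between \<open>fixed_ring R \<delta>\<close> and
      \<open>R\<close>; the zero, and with it the degree bound of \<open>p\<close>, is the
      same.\<close>
    moreover have "p \<in> up (fixed_ring R \<delta>)"
      using up fx by (auto simp: up_def fixed_ring_def)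
    ultimately show ?thesis using up by (simp add: UP_def)
  qed
  ultimately show ?thesis by blast
qed

end
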